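(* Let $k\geq 1$ be an integer and $\delta>0$ a real number. For any sets $X,Y$ and any function $f\colon X\times Y\to[0,1]$, if $f$ admits a $\left(\binom{2k}{k}-1,\,2\delta\right)$-tree, then $f$ admits a $(k,\delta)$-ladder.
   Context: Binary strings: for an integer $t\ge 0$, $2^t$ (written as a set) denotes the set $\{0,1\}^t$ of binary strings of length $t$ ($2^0$ consists of the empty string), and $2^{<t}=\bigcup_{0\le i<t}\{0,1\}^i$. Write $\sigma^\frown\mu$ for concatenation, and $\sigma\trianglelefteq\tau$ if $\sigma$ is an initial segment of $\tau$ (possibly equal to $\tau$). Tree: for an integer $t\geq 1$, a real $\delta>0$ and $f\colon X\times Y\to[0,1]$, a $(t,\delta)$-tree for $f$ consists of sequences $(x_\sigma:\sigma\in 2^{<t})$ from $X$, $(y_\eta:\eta\in\{0,1\}^t)$ from $Y$, and $(r_\sigma:\sigma\in 2^{<t})$ from $[0,1]$ such that for all $\sigma\in 2^{<t}$ and $\eta,\eta'\in\{0,1\}^t$, if $\sigma^\frown 0\trianglelefteq\eta$ and $\sigma^\frown 1\trianglelefteq\eta'$ then $f(x_\sigma,y_\eta)\leq r_\sigma$ and $f(x_\sigma,y_{\eta'})\geq r_\sigma+\delta$. Ladder: for an integer $k\ge1$ and a real $\delta>0$, a $(k,\delta)$-ladder for $f$ consists of $x_1,\dots,x_k\in X$, $y_1,\dots,y_k\in Y$ and $r_1,\dots,r_k\in[0,1]$ such that for all $i,j\in\{1,\dots,k\}$: if $i\leq j$ then $f(x_i,y_j)\geq r_i+\delta$, and if $i>j$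 then $f(x_i,y_j)\leq r_i$. We say $f$ admits such a configuration if one exists for $f$. *)

theory Defs
  imports Complex_Main "HOL-Library.Sublist" "HOL-Library.FuncSet"
begin

text \<open>Binary strings are lists of booleans, the digits 0 and 1 being \<^const>\<open>False\<close> and
  \<^const>\<open>True\<close>; initial segments are given by \<^const>\<open>prefix\<close> (which is reflexive).\<close>

definition strings :: "nat \<Rightarrow> bool list set" where
  "strings t = {\<eta>. length \<eta> = t}"

definition strings_below :: "nat \<Rightarrow> bool list set" where
  "strings_below t = (\<Union>i<t. strings i)"

text \<open>The families \<open>x\<close>, \<open>y\<close>, \<open>r\<close> are total functions of which only the values at the
  relevant indices are constrained.\<close>

definition is_tree ::
  "'a set \<Rightarrow> 'b set \<Rightarrow> ('a \<times> 'b \<Rightarrow> real) \<Rightarrow> nat \<Rightarrow> real \<Rightarrow>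
    (bool list \<Rightarrow> 'a) \<Rightarrow> (bool list \<Rightarrow> 'b) \<Rightarrow> (bool list \<Rightarrow> real) \<Rightarrow> bool" where
  "is_tree X Y f t \<delta> x y r \<longleftrightarrow>
    x \<in> strings_below t \<rightarrow> X \<and> y \<in> strings t \<rightarrow> Y \<and> r \<in> strings_below t \<rightarrow> {0..1} \<and>
    (\<forall>\<sigma>\<in>strings_below t. \<forall>\<eta>\<in>strings t. \<forall>\<eta>'\<in>strings t.
      prefix (\<sigma> @ [False]) \<eta> \<and> prefix (\<sigma> @ [True]) \<eta>' \<longrightarrow>
        f (x \<sigma>, y \<eta>) \<le> r \<sigma> \<and> f (x \<sigma>, y \<eta>') \<ge> r \<sigma> + \<delta>)"

definition admits_tree ::
  "'a set \<Rightarrow> 'b set \<Rightarrow> ('a \<times> 'b \<Rightarrow> real) \<Rightarrow> nat \<Rightarrow> real \<Rightarrow> bool" where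
  "admits_tree X Y f t \<delta> \<longleftrightarrow> (\<exists>x y r. is_tree X Y f t \<delta> x y r)"

definition is_ladder ::
  "'a set \<Rightarrow> 'b set \<Rightarrow> ('a \<times> 'b \<Rightarrow> real) \<Rightarrow> nat \<Rightarrow> real \<Rightarrow>
    (nat \<Rightarrow> 'a) \<Rightarrow> (nat \<Rightarrow> 'b) \<Rightarrow> (nat \<Rightarrow> real) \<Rightarrow> bool" where
  "is_ladder X Y f k \<delta> x y r \<longleftrightarrow>
    x \<in> {1..k} \<rightarrow> X \<and> y \<in> {1..k} \<rightarrow> Y \<and> r \<in> {1..k} \<rightarrow> {0..1} \<and>
    (\<forall>i\<in>{1..k}. \<forall>j\<in>{1..k}.
      (i \<le> j \<longrightarrow> f (x i, y j) \<ge> r i + \<delta>) \<and> (i > j \<longrightarrow> f (x i, y j) \<le> r i))"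

definition admits_ladder ::
  "'a set \<Rightarrow> 'b set \<Rightarrow> ('a \<times> 'b \<Rightarrow> real) \<Rightarrow> nat \<Rightarrow> real \<Rightarrow> bool" where
  "admits_ladder X Y f k \<delta> \<longleftrightarrow> (\<exists>x y r. is_ladder X Y f k \<delta> x y r)"

end

theory Submission
  imports Defs
begin

text \<open>
  A node of the given tree is a pair of a point \<open>x\<close> and a threshold \<open>r\<close>, and a leaf is a point \<open>y\<close>.
  The gap \<open>2\<delta>\<close> is cut in the middle: every node and leaf, however they lie in the tree, satisfy
  \<open>f (x, y) \<ge> r + \<delta>\<close> or \<open>f (x, y) \<le> r + \<delta>\<close> (\<^emph>\<open>weakly\<close> large or small), whereas the tree structure
  yields \<open>f (x, y) \<ge> r + 2\<delta>\<close> or \<open>f (x, y) \<le> r\<close> (\<^emph>\<open>strongly\<close> large or small). A strong and a weak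
  inequality of opposite kinds are separated by \<open>\<delta>\<close>, with threshold \<open>r\<close> if the strong one says small
  and \<open>r + \<delta>\<close> if it says large.

  Fix any leaf \<open>y\<close> and colour the nodes by their weak relation to \<open>y\<close>. A Ramsey property of binary
  trees (\<open>split_tree_partition\<close>) gives a subtree of one colour. If all of its nodes are weakly large
  with \<open>y\<close>, let \<open>p\<close> be its root and continue in the half below \<open>p\<close> whose leaves are strongly small
  with \<open>p\<close>; if all of its nodes are weakly small with \<open>y\<close>, continue in the half whose leaves are
  strongly large with \<open>p\<close>. In both cases \<open>p\<close> is weakly related to \<open>y\<close> and strongly, in the opposite
  sense, to all later leaves, and all later nodes are related to \<open>y\<close> just as \<open>p\<close> is. The pairs
  \<open>(p, y)\<close> from the steps of one kind thus form a staircase, and \<open>k\<close> steps of one kind suffice.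

  If \<open>h a b\<close> is one more than a height that guarantees \<open>a\<close> steps of one kind or \<open>b\<close> of the other,
  this argument works whenever \<open>h a b\<close> is at least \<open>h (a - 1) b + h a (b - 1)\<close>, with
  \<open>h a 0 = h 0 b = 1\<close>. This is the recurrence of Pascal, whence \<open>h k k\<close> may be taken as the central
  binomial coefficient (\<open>split_tree_imp_staircase\<close>).
\<close>

section \<open>Trees that separate leaves\<close>

text \<open>
  The leaves below a node are only required to lie in \<open>M\<close> cut down by the relations of the nodes
  above it. Stated in this way, passing to a subtree is monotonicity in \<open>N\<close> and \<open>M\<close>, and no
  embeddings of binary strings are needed.
\<close>

primrec split_tree ::
  "('p \<Rightarrow> 'b \<Rightarrow> bool) \<Rightarrow> ('p \<Rightarrow> 'b \<Rightarrow> bool) \<Rightarrow> nat \<Rightarrow> 'p set \<Rightarrow> 'b set \<Rightarrow> bool" where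
  "split_tree S U 0 N M \<longleftrightarrow> M \<noteq> {}"
| "split_tree S U (Suc n) N M \<longleftrightarrow>
    (\<exists>p\<in>N. split_tree S U n N {y \<in> M. S p y} \<and> split_tree S U n N {y \<in> M. U p y})"

lemma split_tree_mono:
  assumes "split_tree S U n N M" "N \<subseteq> N'" "M \<subseteq> M'"
  shows "split_tree S U n N' M'"
  using assms
proof (induction n arbitrary: M M')
  case (Suc n)
  then obtain p where p: "p \<in> N" "split_tree S U n N {y \<in> M. S p y}"
    "split_tree S U n N {y \<in> M. U p y}"
    by auto
  have "split_tree S U n N' {y \<in> M'. S p y}" "split_tree S U n N' {y \<in> M'. U p y}"
    using Suc.prems by (auto intro: Suc.IH[OF p(2)] Suc.IH[OF p(3)])
  with p(1) Suc.prems(2) show ?case by auto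
qed auto

lemma split_tree_swap: "split_tree S U n N M \<longleftrightarrow> split_tree U S n N M"
  by (induction n arbitrary: M) auto

lemma split_tree_nonempty:
  assumes "split_tree S U n N M"
  shows "M \<noteq> {}"
  using assms by (induction n arbitrary: M) fastforce+

text \<open>
  Whatever the colour of the root, the demanded height in that colour can be lowered by one in both
  halves. If neither half has the full height in the other colour, both have the lowered height
  in the colour of the root, and the root joins them.
\<close>

lemma split_tree_partition:
  assumes "split_tree S U n N M" "N \<subseteq> A \<union> B" "i + j \<le> Suc n"
  shows "split_tree S U i (N \<inter> A) M \<or> split_tree S U j (N \<inter> B) M"
  using assms
proof (induction n arbitrary: M i j)
  case 0
  then have "i = 0 \<or> j = 0" by auto
  with 0 show ?case by auto
next
  case (Suc n)
  have M: "M \<noteq> {}" using split_tree_nonempty[OF Suc.prems(1)] .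
  from Suc.prems obtain p where p: "p \<in> N" "split_tree S U n N {y \<in> M. S p y}"
    "split_tree S U n N {y \<in> M. U p y}"
    by auto
  show ?case
  proof (cases "i = 0 \<or> j = 0")
    case True
    with M show ?thesis by auto
  next
    case False
    then obtain i' j' where ij: "i = Suc i'" "j = Suc j'"
      by (metis not0_implies_Suc)
    have up: "split_tree S U m K M" if "split_tree S U m K {y \<in> M. P y}" for m K P
      using split_tree_mono[OF that] by auto
    show ?thesis
    proof (cases "p \<in> A")
      case True
      have "split_tree S U i' (N \<inter> A) M' \<or> split_tree S U j (N \<inter> B) M'"
        if "split_tree S U n N M'" for M'
        by (rule Suc.IH[OF that Suc.prems(2)]) (use Suc.prems(3) ij in auto)
      from this[OF p(2)] this[OF p(3)] have "split_tree S U j (N \<inter> B) M \<or>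
          split_tree S U i' (N \<inter> A) {y \<in> M. S p y} \<and> split_tree S U i' (N \<inter> A) {y \<in> M. U p y}"
        using up[of j] by metis
      with True p(1) show ?thesis unfolding ij(1) split_tree.simps by blast
    next
      case False
      with Suc.prems(2) p(1) have "p \<in> B" by auto
      have "split_tree S U i (N \<inter> A) M' \<or> split_tree S U j' (N \<inter> B) M'"
        if "split_tree S U n N M'" for M'
        by (rule Suc.IH[OF that Suc.prems(2)]) (use Suc.prems(3) ij in auto)
      from this[OF p(2)] this[OF p(3)] have "split_tree S U i (N \<inter> A) M \<or>
          split_tree S U j' (N \<inter> B) {y \<in> M. S p y} \<and> split_tree S U j' (N \<inter> B) {y \<in> M. U p y}"
        using up[of i] by metis
      with \<open>p \<in> B\<close> p(1) show ?thesis unfolding ij(2) split_tree.simps by blast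
    qed
  qed
qed

section \<open>Staircases\<close>

text \<open>
  \<open>W\<close> is the relation of a node to the leaves up to its own step, and \<open>Q\<close> the one to the later
  leaves. The nonempty \<open>M\<close> at the end gives one more leaf than nodes. It serves the case in which
  \<open>Q\<close> says large, since a ladder requires each of its \<open>x\<close> to be large with some \<open>y\<close>.
\<close>

primrec staircase ::
  "('p \<Rightarrow> 'b \<Rightarrow> bool) \<Rightarrow> ('p \<Rightarrow> 'b \<Rightarrow> bool) \<Rightarrow> nat \<Rightarrow> 'p set \<Rightarrow> 'b set \<Rightarrow> bool" where
  "staircase W Q 0 N M \<longleftrightarrow> M \<noteq> {}"
| "staircase W Q (Suc n) N M \<longleftrightarrow>
    (\<exists>p\<in>N. \<exists>y\<in>M. W p y \<and> staircase W Q n {q \<in> N. W q y} {z \<in> M. Q p z})"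

lemma staircase_mono:
  assumes "staircase W Q n N M" "N \<subseteq> N'" "M \<subseteq> M'"
  shows "staircase W Q n N' M'"
  using assms
proof (induction n arbitrary: N N' M M')
  case (Suc n)
  then obtain p y where py: "p \<in> N" "y \<in> M" "W p y"
    "staircase W Q n {q \<in> N. W q y} {z \<in> M. Q p z}"
    by auto
  have "staircase W Q n {q \<in> N'. W q y} {z \<in> M'. Q p z}"
    using Suc.prems by (auto intro: Suc.IH[OF py(4)])
  with py Suc.prems show ?case by auto
qed auto

text \<open>
  One step in the construction of a staircase: all nodes of the tree stand in the relation \<open>W\<close> to
  \<open>y\<close>, and its root is removed together with the half below it that is not known to satisfy \<open>Q\<close>. The
  property \<open>R\<close> stands for a staircase of the other kind, which lets one lemma serve both colours.
\<close>

lemma staircase_step: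
  assumes tree: "split_tree Q V (Suc n) {q \<in> N. W q y} M" and "y \<in> M"
    and IH: "\<And>N' M'. split_tree Q V n N' M' \<Longrightarrow> N' \<subseteq> N \<Longrightarrow> M' \<subseteq> M \<Longrightarrow> staircase W Q a N' M' \<or> R N' M'"
  shows "staircase W Q (Suc a) N M \<or> (\<exists>N' \<subseteq> N. \<exists>M' \<subseteq> M. R N' M')"
proof -
  from tree obtain p where p: "p \<in> N" "W p y"
    "split_tree Q V n {q \<in> N. W q y} {z \<in> M. Q p z}"
    by auto
  have "staircase W Q a {q \<in> N. W q y} {z \<in> M. Q p z} \<or> R {q \<in> N. W q y} {z \<in> M. Q p z}"
    by (rule IH[OF p(3)]) auto
  then show ?thesis
  proof
    assume "staircase W Q a {q \<in> N. W q y} {z \<in> M. Q p z}"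
    with p \<open>y \<in> M\<close> show ?thesis by auto
  next
    assume "R {q \<in> N. W q y} {z \<in> M. Q p z}"
    then show ?thesis by (intro disjI2 exI conjI) auto
  qed
qed

text \<open>
  The binomial coefficient is the sum of \<open>(a + b - 1) choose (a - 1)\<close> and \<open>(a + b - 1) choose a\<close>.
  The partition by the weak relation to a leaf gives a tree of the first height whose nodes satisfy
  \<open>L\<close> or one of the second height whose nodes satisfy \<open>W\<close>. The step uses up the root, and one less
  than these heights is just what the induction demands for \<open>(a - 1, b)\<close> and \<open>(a, b - 1)\<close>.
\<close>

lemma split_tree_imp_staircase:
  assumes "split_tree S U n N M" "(a + b) choose a \<le> Suc n"
    and "\<And>p y. p \<in> N \<Longrightarrow> y \<in> M \<Longrightarrow> L p y \<or> W p y"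
  shows "staircase L S a N M \<or> staircase W U b N M"
  using assms
proof (induction "a + b" arbitrary: a b n N M)
  case 0
  then show ?case by (auto dest: split_tree_nonempty)
next
  case (Suc c)
  have M: "M \<noteq> {}" using split_tree_nonempty[OF Suc.prems(1)] .
  show ?case
  proof (cases "a = 0 \<or> b = 0")
    case True
    with M show ?thesis by auto
  next
    case False
    then obtain a' b' where ab: "a = Suc a'" "b = Suc b'"
      by (metis not0_implies_Suc)
    have "(a' + b) choose a' > 0" "(a + b') choose a > 0" by simp_all
    then obtain i j where i: "(a' + b) choose a' = Suc i" and j: "(a + b') choose a = Suc j"
      by (meson gr0_implies_Suc)
    have pascal: "(a + b) choose a = Suc i + Suc j"
      using i j ab by simp
    from M obtain y where y: "y \<in> M" by auto
    have "N \<subseteq> {q. L q y} \<union> {q. W q y}"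
      using Suc.prems(3) y by auto
    from split_tree_partition[OF Suc.prems(1) this, of "Suc i" "Suc j"]
    consider "split_tree S U (Suc i) {q \<in> N. L q y} M"
      | "split_tree S U (Suc j) {q \<in> N. W q y} M"
      using pascal Suc.prems(2) by (auto simp: Collect_conj_eq)
    then show ?thesis
    proof cases
      case 1
      have "staircase L S (Suc a') N M \<or> (\<exists>N' \<subseteq> N. \<exists>M' \<subseteq> M. staircase W U b N' M')"
      proof (rule staircase_step[where W = L, OF 1 y])
        fix N' M' assume "split_tree S U i N' M'" "N' \<subseteq> N" "M' \<subseteq> M"
        then show "staircase L S a' N' M' \<or> staircase W U b N' M'"
          by (intro Suc.hyps(1)[of a' b i]) (use Suc.hyps(2) ab i Suc.prems(3) in auto)
      qed
      then show ?thesis unfolding ab(1) using staircase_mono[of W U b] by blast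
    next
      case 2
      then have "split_tree U S (Suc j) {q \<in> N. W q y} M"
        using split_tree_swap by blast
      then have "staircase W U (Suc b') N M \<or> (\<exists>N' \<subseteq> N. \<exists>M' \<subseteq> M. staircase L S a N' M')"
      proof (rule staircase_step[where W = W, OF _ y])
        fix N' M' assume "split_tree U S j N' M'" "N' \<subseteq> N" "M' \<subseteq> M"
        then have "staircase L S a N' M' \<or> staircase W U b' N' M'"
          unfolding split_tree_swap[of U S]
          by (intro Suc.hyps(1)[of a b' j]) (use Suc.hyps(2) ab j Suc.prems(3) in auto)
        then show "staircase W U b' N' M' \<or> staircase L S a N' M'" by blast
      qed
      then show ?thesis unfolding ab(2) using staircase_mono[of L S a] by blast
    qed
  qed
qed

lemma staircase_sequences:
  assumes "staircase W Q n N M"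
  obtains p y where "\<And>i. i < n \<Longrightarrow> p i \<in> N" "\<And>j. j \<le> n \<Longrightarrow> y j \<in> M"
    "\<And>i j. i < n \<Longrightarrow> j \<le> i \<Longrightarrow> W (p i) (y j)"
    "\<And>i j. i < j \<Longrightarrow> j \<le> n \<Longrightarrow> Q (p i) (y j)"
proof -
  from assms have "\<exists>p y. (\<forall>i<n. p i \<in> N) \<and> (\<forall>j\<le>n. y j \<in> M) \<and> (\<forall>i<n. \<forall>j\<le>i. W (p i) (y j)) \<and>
      (\<forall>j\<le>n. \<forall>i<j. Q (p i) (y j))"
  proof (induction n arbitrary: N M)
    case 0
    then obtain z where "z \<in> M" by auto
    then show ?case by (intro exI[of _ undefined] exI[of _ "\<lambda>_. z"]) simp
  next
    case (Suc n)
    then obtain p0 y0 where 0: "p0 \<in> N" "y0 \<in> M" "W p0 y0"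
      "staircase W Q n {q \<in> N. W q y0} {z \<in> M. Q p0 z}"
      by auto
    from Suc.IH[OF 0(4)] obtain p y where py:
      "\<forall>i<n. p i \<in> {q \<in> N. W q y0}" "\<forall>j\<le>n. y j \<in> {z \<in> M. Q p0 z}"
      "\<forall>i<n. \<forall>j\<le>i. W (p i) (y j)" "\<forall>j\<le>n. \<forall>i<j. Q (p i) (y j)"
      by blast
    let ?p = "case_nat p0 p" and ?y = "case_nat y0 y"
    have "?p i \<in> N" if "i < Suc n" for i
      using that 0(1) py(1) by (cases i) simp_all
    moreover have "?y j \<in> M" if "j \<le> Suc n" for j
      using that 0(2) py(2) by (cases j) simp_all
    moreover have "W (?p i) (?y j)" if "i < Suc n" "j \<le> i" for i j
      using that 0(3) py(1,3) by (cases i; cases j) simp_all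
    moreover have "Q (?p i) (?y j)" if "j \<le> Suc n" "i < j" for i j
      using that py(2,4) by (cases i; cases j) simp_all
    ultimately show ?case by (intro exI[of _ ?p] exI[of _ ?y] conjI allI impI)
  qed
  then obtain p y where "\<forall>i<n. p i \<in> N" "\<forall>j\<le>n. y j \<in> M" "\<forall>i<n. \<forall>j\<le>i. W (p i) (y j)"
    "\<forall>j\<le>n. \<forall>i<j. Q (p i) (y j)"
    by (elim exE conjE)
  then show ?thesis by (intro that[of p y]) simp_all
qed

section \<open>From trees to ladders of real-valued functions\<close>

lemma is_tree_imp_split_tree:
  assumes "is_tree X Y f t \<epsilon> x y r"
  shows "split_tree (\<lambda>p y. f (fst p, y) \<le> snd p) (\<lambda>p y. f (fst p, y) \<ge> snd p + \<epsilon>) t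
    (X \<times> {0..1}) Y"
    (is "split_tree ?S ?U t ?N Y")
proof -
  have x: "x \<sigma> \<in> X" and r: "r \<sigma> \<in> {0..1}" if "length \<sigma> < t" for \<sigma>
    using assms that unfolding is_tree_def strings_below_def strings_def by blast+
  have y: "y \<eta> \<in> Y" if "length \<eta> = t" for \<eta>
    using assms that unfolding is_tree_def strings_def by blast
  have sep: "f (x \<sigma>, y \<eta>) \<le> r \<sigma> \<and> f (x \<sigma>, y \<eta>') \<ge> r \<sigma> + \<epsilon>"
    if "length \<sigma> < t" "length \<eta> = t" "length \<eta>' = t"
      "prefix (\<sigma> @ [False]) \<eta>" "prefix (\<sigma> @ [True]) \<eta>'" for \<sigma> \<eta> \<eta>'
    using assms that unfolding is_tree_def strings_below_def strings_def by blast
  \<comment> \<open>The separation of the tree speaks of two leaves at once. To apply it to one leaf, one on the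
    other side of \<open>\<sigma>\<close> is needed.\<close>
  have extend: "\<exists>\<eta>. length \<eta> = t \<and> prefix (\<sigma> @ [b]) \<eta>" if "length \<sigma> < t"
    for \<sigma> :: "bool list" and b
    using that by (intro exI[of _ "(\<sigma> @ [b]) @ replicate (t - Suc (length \<sigma>)) False"]) auto
  have small: "f (x \<sigma>, y \<eta>) \<le> r \<sigma>"
    if "length \<sigma> < t" "length \<eta> = t" "prefix (\<sigma> @ [False]) \<eta>" for \<sigma> \<eta>
    using extend[OF that(1), of True] sep[OF that(1,2) _ that(3)] by blast
  have large: "f (x \<sigma>, y \<eta>) \<ge> r \<sigma> + \<epsilon>"
    if "length \<sigma> < t" "length \<eta> = t" "prefix (\<sigma> @ [True]) \<eta>" for \<sigma> \<eta>
    using extend[OF that(1), of False] sep[OF that(1) _ that(2) _ that(3)] by blast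
  have "split_tree ?S ?U n ?N (y ` {\<eta>. length \<eta> = t \<and> prefix \<sigma> \<eta>})"
    if "length \<sigma> + n = t" for n \<sigma>
    using that
  proof (induction n arbitrary: \<sigma>)
    case 0
    then have "\<sigma> \<in> {\<eta>. length \<eta> = t \<and> prefix \<sigma> \<eta>}" by simp
    then show ?case unfolding split_tree.simps by blast
  next
    case (Suc n)
    have \<sigma>: "length \<sigma> < t" using Suc.prems by simp
    have IH: "split_tree ?S ?U n ?N (y ` {\<eta>. length \<eta> = t \<and> prefix (\<sigma> @ [b]) \<eta>})" for b
      by (rule Suc.IH) (use Suc.prems in simp)
    let ?M = "y ` {\<eta>. length \<eta> = t \<and> prefix \<sigma> \<eta>}"
    have below: "y ` {\<eta>. length \<eta> = t \<and> prefix (\<sigma> @ [b]) \<eta>} \<subseteq> ?M" for b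
      using append_prefixD by blast
    have "split_tree ?S ?U n ?N {z \<in> ?M. ?S (x \<sigma>, r \<sigma>) z}"
    proof (rule split_tree_mono[OF IH[of False] subset_refl])
      show "y ` {\<eta>. length \<eta> = t \<and> prefix (\<sigma> @ [False]) \<eta>} \<subseteq> {z \<in> ?M. ?S (x \<sigma>, r \<sigma>) z}"
        using small[OF \<sigma>] below[of False] unfolding fst_conv snd_conv by blast
    qed
    moreover have "split_tree ?S ?U n ?N {z \<in> ?M. ?U (x \<sigma>, r \<sigma>) z}"
    proof (rule split_tree_mono[OF IH[of True] subset_refl])
      show "y ` {\<eta>. length \<eta> = t \<and> prefix (\<sigma> @ [True]) \<eta>} \<subseteq> {z \<in> ?M. ?U (x \<sigma>, r \<sigma>) z}"
        using large[OF \<sigma>] below[of True] unfolding fst_conv snd_conv by blast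
    qed
    moreover have "(x \<sigma>, r \<sigma>) \<in> ?N" using x[OF \<sigma>] r[OF \<sigma>] by simp
    ultimately show ?case unfolding split_tree.simps(2) by blast
  qed
  from this[of "[]" t] have "split_tree ?S ?U t ?N (y ` {\<eta>. length \<eta> = t})" by simp
  then show ?thesis by (rule split_tree_mono) (use y in auto)
qed

text \<open>
  A node is weakly large with the leaves of its own and of earlier steps, whereas a ladder wants each
  \<open>x\<close> large with the \<open>y\<close> of its own and of later rungs. Hence the steps are taken in reverse order.
\<close>

lemma descending_staircase_imp_ladder:
  assumes "staircase (\<lambda>p y. f (fst p, y) \<ge> snd p + \<delta>) (\<lambda>p y. f (fst p, y) \<le> snd p) k (X \<times> {0..1}) Y"
  shows "admits_ladder X Y f k \<delta>"
proof -
  obtain p y where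
    p: "\<And>i. i < k \<Longrightarrow> p i \<in> X \<times> {0..1}" and y: "\<And>j. j \<le> k \<Longrightarrow> y j \<in> Y"
    and large: "\<And>i j. i < k \<Longrightarrow> j \<le> i \<Longrightarrow> f (fst (p i), y j) \<ge> snd (p i) + \<delta>"
    and small: "\<And>i j. i < j \<Longrightarrow> j \<le> k \<Longrightarrow> f (fst (p i), y j) \<le> snd (p i)"
    by (rule staircase_sequences[OF assms], rule that, blast+)
  have "is_ladder X Y f k \<delta> (\<lambda>i. fst (p (k - i))) (\<lambda>j. y (k - j)) (\<lambda>i. snd (p (k - i)))"
    unfolding is_ladder_def
  proof (intro conjI ballI impI funcsetI)
    fix i assume "i \<in> {1..k}"
    then have "p (k - i) \<in> X \<times> {0..1}" by (intro p) auto
    then show "fst (p (k - i)) \<in> X" "snd (p (k - i)) \<in> {0..1}" by auto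
  qed (auto intro!: y large small)
  then show ?thesis unfolding admits_ladder_def by blast
qed

text \<open>
  A node is strongly large only with leaves of later steps, hence the shift by one between the
  nodes and the leaves.
\<close>

lemma ascending_staircase_imp_ladder:
  assumes "staircase (\<lambda>p y. f (fst p, y) \<le> snd p + \<delta>) (\<lambda>p y. f (fst p, y) \<ge> snd p + 2 * \<delta>) k
      (X \<times> {0..1}) Y"
    and "\<delta> \<ge> 0" and f: "f \<in> X \<times> Y \<rightarrow> {0..1}"
  shows "admits_ladder X Y f k \<delta>"
proof -
  obtain p y where
    p: "\<And>i. i < k \<Longrightarrow> p i \<in> X \<times> {0..1}" and y: "\<And>j. j \<le> k \<Longrightarrow> y j \<in> Y"
    and small: "\<And>i j. i < k \<Longrightarrow> j \<le> i \<Longrightarrow> f (fst (p i), y j) \<le> snd (p i) + \<delta>"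
    and large: "\<And>i j. i < j \<Longrightarrow> j \<le> k \<Longrightarrow> f (fst (p i), y j) \<ge> snd (p i) + 2 * \<delta>"
    by (rule staircase_sequences[OF assms(1)], rule that, blast+)
  have "is_ladder X Y f k \<delta> (\<lambda>i. fst (p (i - 1))) y (\<lambda>i. snd (p (i - 1)) + \<delta>)"
    unfolding is_ladder_def
  proof (intro conjI ballI impI funcsetI)
    fix i assume i: "i \<in> {1..k}"
    then have P: "p (i - 1) \<in> X \<times> {0..1}" by (intro p) auto
    then show "fst (p (i - 1)) \<in> X" by auto
    \<comment> \<open>The raised threshold stays below 1 because some value of \<open>f\<close> exceeds it by \<open>\<delta>\<close>.\<close>
    have "f (fst (p (i - 1)), y k) \<in> {0..1}"
      using P y[of k] f by (auto simp: Pi_def)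
    moreover have "f (fst (p (i - 1)), y k) \<ge> snd (p (i - 1)) + 2 * \<delta>"
      using i by (intro large) auto
    ultimately show "snd (p (i - 1)) + \<delta> \<in> {0..1}"
      using P \<open>\<delta> \<ge> 0\<close> by (auto simp: mem_Times_iff)
  next
    fix i j assume "i \<in> {1..k}" "j \<in> {1..k}" "i \<le> j"
    then show "f (fst (p (i - 1)), y j) \<ge> snd (p (i - 1)) + \<delta> + \<delta>"
      using large[of "i - 1" j] by force
  qed (auto intro!: y small)
  then show ?thesis unfolding admits_ladder_def by blast
qed

theorem theorem1p11:
  fixes k :: nat and \<delta> :: real
    and X :: "'a set" and Y :: "'b set" and f :: "'a \<times> 'b \<Rightarrow> real"
  assumes "k \<ge> 1"
    and "\<delta> > 0"
    and "f \<in> X \<times> Y \<rightarrow> {0..1}"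
    and "admits_tree X Y f (((2 * k) choose k) - 1) (2 * \<delta>)"
  shows "admits_ladder X Y f k \<delta>"
proof -
  from assms(4) have tree: "split_tree (\<lambda>p y. f (fst p, y) \<le> snd p)
      (\<lambda>p y. f (fst p, y) \<ge> snd p + 2 * \<delta>) (((2 * k) choose k) - 1) (X \<times> {0..1}) Y"
    unfolding admits_tree_def using is_tree_imp_split_tree by blast
  have "staircase (\<lambda>p y. f (fst p, y) \<ge> snd p + \<delta>) (\<lambda>p y. f (fst p, y) \<le> snd p) k (X \<times> {0..1}) Y \<or>
      staircase (\<lambda>p y. f (fst p, y) \<le> snd p + \<delta>) (\<lambda>p y. f (fst p, y) \<ge> snd p + 2 * \<delta>) k
        (X \<times> {0..1}) Y"
    by (rule split_tree_imp_staircase[OF tree]) (auto simp: mult_2)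
  then show ?thesis
  proof
    assume "staircase (\<lambda>p y. f (fst p, y) \<ge> snd p + \<delta>) (\<lambda>p y. f (fst p, y) \<le> snd p) k (X \<times> {0..1}) Y"
    then show ?thesis by (rule descending_staircase_imp_ladder)
  next
    assume "staircase (\<lambda>p y. f (fst p, y) \<le> snd p + \<delta>) (\<lambda>p y. f (fst p, y) \<ge> snd p + 2 * \<delta>) k
      (X \<times> {0..1}) Y"
    then show ?thesis using assms(2,3) by (intro ascending_staircase_imp_ladder) auto
  qed
qed

end
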